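(* Let $n>4$ and let $G$ be any partially switched $n$-cube, with adjacency matrix $A$ (see context). Then at least $1/8$ of the vertices of $G$ pair up to exhibit perfect state transfer at time $\pi/2$. Specifically, for every choice of $m_4,\dots,m_{n-1}\in\{0,1\}$ there is perfect state transfer at time $\pi/2$ between the vertices $1+2^4m_4+2^5m_5+\cdots+2^{n-1}m_{n-1}$ and $16+2^4(1-m_4)+2^5(1-m_5)+\cdots+2^{n-1}(1-m_{n-1})$; so all vertices of the set $S=\{1+2^4m_4+\cdots+2^{n-1}m_{n-1},\ 16+2^4m_4+\cdots+2^{n-1}m_{n-1} : m_k\in\{0,1\}\}$ pair up to exhibit PST. Furthermore, for every $j\in S$, every vertex $k$ and every time $t$, the fidelity of state transfer from $j$ to $k$ in $G$ equals the fidelity of state transfer from $j$ to $k$ in the $n$-cube, i.e. $|\langle j|e^{itA}|k\rangle|^2=|\langle j|e^{itA_{n,1}}|k\rangle|^2$.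
   Context: For $m\ge 0$ let $C_m$ be the $2^m\times 2^m$ adjacency matrix of the $m$-cube with vertices labelled $1,\dots,2^m$, where $a$ and $b$ are adjacent iff the binary representations of $a-1$ and $b-1$ differ in exactly one bit. Let $A_{4,1}$ be the adjacency matrix of the 4-cube on vertices $\{1,\dots,16\}$ with edges $\{1,2\},\{1,3\},\{1,4\},\{1,5\}$; $\{2,6\},\{2,7\},\{2,9\},\{3,6\},\{3,8\},\{3,10\},\{4,7\},\{4,8\},\{4,11\},\{5,9\},\{5,10\},\{5,11\}$; $\{6,12\},\{6,13\},\{7,12\},\{7,14\},\{8,12\},\{8,15\},\{9,13\},\{9,14\},\{10,13\},\{10,15\},\{11,14\},\{11,15\}$; $\{12,16\},\{13,16\},\{14,16\},\{15,16\}$. Let $A_{4,2}$ be the adjacency matrix of the switched 4-cube, the graph on $\{1,\dots,16\}$ with the same edges except that the twelve edges between $\{2,3,4,5\}$ and $\{6,\dots,11\}$ are replaced by $\{2,8\},\{2,10\},\{2,11\},\{3,7\},\{3,9\},\{3,11\},\{4,6\},\{4,9\},\{4,10\},\{5,6\},\{5,7\},\{5,8\}$. For $n\ge 4$, the $n$-cube has adjacency matrix $A_{n,1}=C_{n-4}\otimes I_{16}+I_{2^{n-4}}\otimes A_{4,1}$ (vertices $\{1,\dots,2^n\}$). A partially switched $n$-cube is the graph on $\{1,\dots,2^n\}$ with adjacency matrix $\mathrm{diag}(B_1,\dots,B_{2^{n-4}})+C_{n-4}\otimes I_{16}$, where each $B_i\in\{A_{4,1},A_{4,2}\}$ and some,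 but not all, $B_i$ equal $A_{4,2}$. For a graph with adjacency matrix $A$, the fidelity of state transfer from $j$ to $k$ at time $t$ is $|\langle j|e^{itA}|k\rangle|^2$ ($|j\rangle$ the $j$-th standard basis vector), and there is perfect state transfer (PST) between distinct $j,k$ at time $t_0$ if this fidelity equals $1$ at $t_0$. *)

theory Defs
  imports Complex_Main "Jordan_Normal_Form.Matrix"
begin

(* Vertices are labelled 1, ..., N, whereas matrix and vector indices start at 0:
   vertex v always corresponds to index v - 1. *)

definition adj_mat :: "nat \<Rightarrow> nat set set \<Rightarrow> complex mat" where
  "adj_mat N E = mat N N (\<lambda>(i, j). if {i + 1, j + 1} \<in> E then 1 else 0)"

definition cube_mat :: "nat \<Rightarrow> complex mat" where
  "cube_mat m = adj_mat (2 ^ m)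
     {{a, b} | a b. a \<in> {1..2 ^ m} \<and> b \<in> {1..2 ^ m} \<and>
        (\<exists>!k. bit (a - 1) k \<noteq> bit (b - 1) k)}"

definition edges_common :: "nat set set" where
  "edges_common =
     {{1,2}, {1,3}, {1,4}, {1,5},
      {6,12}, {6,13}, {7,12}, {7,14}, {8,12}, {8,15},
      {9,13}, {9,14}, {10,13}, {10,15}, {11,14}, {11,15},
      {12,16}, {13,16}, {14,16}, {15,16}}"

definition A41 :: "complex mat" where
  "A41 = adj_mat 16 (edges_common \<union>
     {{2,6}, {2,7}, {2,9}, {3,6}, {3,8}, {3,10},
      {4,7}, {4,8}, {4,11}, {5,9}, {5,10}, {5,11}})"

definition A42 :: "complex mat" where
  "A42 = adj_mat 16 (edges_common \<union>
     {{2,8}, {2,10}, {2,11}, {3,7}, {3,9}, {3,11},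
      {4,6}, {4,9}, {4,10}, {5,6}, {5,7}, {5,8}})"

definition kronecker :: "complex mat \<Rightarrow> complex mat \<Rightarrow> complex mat" where
  "kronecker A B = mat (dim_row A * dim_row B) (dim_col A * dim_col B)
     (\<lambda>(i, j). A $$ (i div dim_row B, j div dim_col B) * B $$ (i mod dim_row B, j mod dim_col B))"

definition ncube_mat :: "nat \<Rightarrow> complex mat" where
  "ncube_mat n =
     kronecker (cube_mat (n - 4)) (1\<^sub>m 16) + kronecker (1\<^sub>m (2 ^ (n - 4))) A41"

definition partially_switched_cube :: "nat \<Rightarrow> complex mat \<Rightarrow> bool" where
  "partially_switched_cube n A \<longleftrightarrow> n \<ge> 4 \<and>
     (\<exists>Bs. length Bs = 2 ^ (n - 4) \<and> set Bs \<subseteq> {A41, A42} \<and>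
        (\<exists>B \<in> set Bs. B = A42) \<and> \<not> (\<forall>B \<in> set Bs. B = A42) \<and>
        A = diag_block_mat Bs + kronecker (cube_mat (n - 4)) (1\<^sub>m 16))"

(* The exponential series, taken entrywise; it converges for every square matrix. *)
definition mat_exp :: "complex mat \<Rightarrow> complex mat" where
  "mat_exp A = mat (dim_row A) (dim_row A) (\<lambda>(i, j). \<Sum>k. (A ^\<^sub>m k) $$ (i, j) / fact k)"

definition ket :: "nat \<Rightarrow> nat \<Rightarrow> complex vec" where
  "ket N j = unit_vec N (j - 1)"

(* No conjugation is needed for the bra, since the basis vector is real. *)
definition fidelity :: "complex mat \<Rightarrow> nat \<Rightarrow> nat \<Rightarrow> real \<Rightarrow> real" where
  "fidelity A j k t =
     (cmod (ket (dim_row A) j \<bullet>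
        (mat_exp ((\<i> * complex_of_real t) \<cdot>\<^sub>m A) *\<^sub>v ket (dim_row A) k)))\<^sup>2"

definition PST :: "complex mat \<Rightarrow> nat \<Rightarrow> nat \<Rightarrow> real \<Rightarrow> bool" where
  "PST A j k t \<longleftrightarrow>
     j \<in> {1..dim_row A} \<and> k \<in> {1..dim_row A} \<and> j \<noteq> k \<and> fidelity A j k t = 1"

definition pairs_up_PST :: "complex mat \<Rightarrow> nat set \<Rightarrow> real \<Rightarrow> bool" where
  "pairs_up_PST A P t \<longleftrightarrow>
     (\<exists>\<sigma>. \<forall>v \<in> P. \<sigma> v \<in> P \<and> \<sigma> (\<sigma> v) = v \<and> PST A v (\<sigma> v) t)"

definition S_set :: "nat \<Rightarrow> nat set" where
  "S_set n = (\<Union>m \<in> {m. \<forall>k \<in> {4..<n}. m k \<in> {0, 1}}.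
     {1 + (\<Sum>k = 4..<n. 2 ^ k * m k), 16 + (\<Sum>k = 4..<n. 2 ^ k * m k)})"

end

(* The 4-cube and the switched 4-cube have the same distance layers around vertex 1, of sizes
   1, 4, 6, 4, 1, and in both a vertex of layer l has l neighbours in layer l - 1 and 4 - l in layer
   l + 1. Hence the vectors i |-> K_d(layer i), with K_d the Krawtchouk polynomials of degree d <= 4,
   are eigenvectors of A41 and of A42 for the same eigenvalue 4 - 2d. Their tensor products with the
   characters chi_s of the (n-4)-cube are common eigenvectors, for n - 2|s| - 2d, of every partially
   switched n-cube and of the n-cube; the basis vectors of S lie in their span. So the rows of e^{itA}
   indexed by S agree with those of the n-cube. At t = pi/2 the phase of each eigenvector is
   i^n (-1)^(|s|+d), and (-1)^(|s|+d) is cancelled by the sign relating its values at antipodes. *)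

theory Submission
  imports Defs
begin

section \<open>Rows of the matrix exponential from left eigenvectors\<close>

text \<open>Row \<open>j\<close> of a power of \<open>A\<close> is the unit row vector at
  \<open>j\<close> multiplied repeatedly by \<open>A\<close> from the right. Only this one vector
  has to lie in the span of the left eigenvectors; each further factor \<open>A\<close> multiplies
  its terms by their eigenvalues.\<close>

lemma pow_mat_spectral:
  fixes A :: "complex mat"
  assumes A: "A \<in> carrier_mat N N" and j: "j < N" and k: "k < N"
    and eig: "\<And>r l. r \<in> R \<Longrightarrow> l < N \<Longrightarrow> (\<Sum>i<N. v r i * A $$ (i, l)) = \<mu> r * v r l"
    and decomp: "\<And>i. i < N \<Longrightarrow> (\<Sum>r\<in>R. c r * v r i) = of_bool (i = j)"
  shows "(A ^\<^sub>m p) $$ (j, k) = (\<Sum>r\<in>R. c r * v r k * \<mu> r ^ p)"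
  using k
proof (induction p arbitrary: k)
  case 0
  then show ?case
    using A j decomp[of k] by (auto simp: one_mat_def)
next
  case (Suc p)
  have P: "A ^\<^sub>m p \<in> carrier_mat N N"
    using A by simp
  have "(A ^\<^sub>m Suc p) $$ (j, k) = (\<Sum>i<N. (A ^\<^sub>m p) $$ (j, i) * A $$ (i, k))"
    using A P j Suc.prems by (auto simp: scalar_prod_def lessThan_atLeast0)
  also have "\<dots> = (\<Sum>i<N. \<Sum>r\<in>R. c r * v r i * \<mu> r ^ p * A $$ (i, k))"
    by (rule sum.cong) (auto simp: Suc.IH sum_distrib_right)
  also have "\<dots> = (\<Sum>r\<in>R. c r * \<mu> r ^ p * (\<Sum>i<N. v r i * A $$ (i, k)))"
    by (subst sum.swap) (simp add: sum_distrib_left mult_ac)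
  also have "\<dots> = (\<Sum>r\<in>R. c r * v r k * \<mu> r ^ Suc p)"
    by (rule sum.cong) (auto simp: eig Suc.prems)
  finally show ?case .
qed

text \<open>Scaling by \<open>z\<close> scales the eigenvalues, so the entrywise series becomes a
  finite combination of scalar exponential series.\<close>

lemma mat_exp_spectral:
  fixes A :: "complex mat"
  assumes A: "A \<in> carrier_mat N N" and j: "j < N" and k: "k < N"
    and eig: "\<And>r l. r \<in> R \<Longrightarrow> l < N \<Longrightarrow> (\<Sum>i<N. v r i * A $$ (i, l)) = \<mu> r * v r l"
    and decomp: "\<And>i. i < N \<Longrightarrow> (\<Sum>r\<in>R. c r * v r i) = of_bool (i = j)"
  shows "mat_exp (z \<cdot>\<^sub>m A) $$ (j, k) = (\<Sum>r\<in>R. c r * v r k * exp (z * \<mu> r))"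
proof -
  have eig': "(\<Sum>i<N. v r i * (z \<cdot>\<^sub>m A) $$ (i, l)) = z * \<mu> r * v r l" if "r \<in> R" "l < N" for r l
  proof -
    have "(\<Sum>i<N. v r i * (z \<cdot>\<^sub>m A) $$ (i, l)) = z * (\<Sum>i<N. v r i * A $$ (i, l))"
      unfolding sum_distrib_left using A that by (intro sum.cong) auto
    then show ?thesis
      using eig that by simp
  qed
  have pow: "((z \<cdot>\<^sub>m A) ^\<^sub>m p) $$ (j, k) = (\<Sum>r\<in>R. c r * v r k * (z * \<mu> r) ^ p)" for p
    by (rule pow_mat_spectral[where N = N]) (use A j k eig' decomp in auto)
  have exp_sums: "(\<lambda>p. x ^ p / fact p) sums exp x" for x :: complex
    using exp_converges[of x] by (simp add: scaleR_conv_of_real divide_inverse mult.commute)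
  have "(\<lambda>p. \<Sum>r\<in>R. c r * v r k * ((z * \<mu> r) ^ p / fact p)) sums
      (\<Sum>r\<in>R. c r * v r k * exp (z * \<mu> r))"
    by (intro sums_sum sums_mult exp_sums)
  then have "(\<Sum>p. ((z \<cdot>\<^sub>m A) ^\<^sub>m p) $$ (j, k) / fact p) =
      (\<Sum>r\<in>R. c r * v r k * exp (z * \<mu> r))"
    by (simp add: pow sum_divide_distrib sums_iff)
  then show ?thesis
    using A j k by (simp add: mat_exp_def)
qed

lemma fidelity_eq_entry:
  assumes "dim_row A = N" "j \<in> {1..N}" "k \<in> {1..N}"
  shows "fidelity A j k t = (cmod (mat_exp ((\<i> * complex_of_real t) \<cdot>\<^sub>m A) $$ (j - 1, k - 1)))\<^sup>2"
proof -
  define M where "M = mat_exp ((\<i> * complex_of_real t) \<cdot>\<^sub>m A)"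
  have M: "M \<in> carrier_mat N N"
    using assms by (simp add: M_def mat_exp_def)
  have "M *\<^sub>v unit_vec N (k - 1) = col M (k - 1)"
    using M assms by (intro eq_vecI) auto
  then show ?thesis
    using M assms(2,3) unfolding fidelity_def ket_def M_def[symmetric] assms(1)
    by (subst scalar_prod_left_unit[of _ N]) auto
qed

section \<open>Characters of the m-cube\<close>

text \<open>The Walsh character of a finite set \<open>s\<close> of bit positions.\<close>

definition cube_char :: "nat set \<Rightarrow> nat \<Rightarrow> complex" where
  "cube_char s a = (\<Prod>k\<in>s. if bit a k then -1 else 1)"

lemma bit_less_exp_nat: "bit a k \<Longrightarrow> (a :: nat) < 2 ^ m \<Longrightarrow> k < m"
  by (metis bit_take_bit_iff take_bit_nat_eq_self)

lemma eq_iff_bits_below: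
  fixes a b :: nat
  assumes "a < 2 ^ m" "b < 2 ^ m"
  shows "a = b \<longleftrightarrow> (\<forall>k<m. bit a k = bit b k)"
  using assms bit_less_exp_nat by (auto simp: bit_eq_iff)

text \<open>The product of the two values is a product over \<open>s\<close> of signs
  \<open>f k\<close> telling whether bit \<open>k\<close> agrees. Summing over all \<open>s\<close>
  expands the product of the \<open>f k + 1\<close>, which has a zero factor as soon as
  \<open>a\<close> and \<open>b\<close> differ.\<close>

lemma cube_char_orthogonal:
  assumes "a < 2 ^ m" "b < 2 ^ m"
  shows "(\<Sum>s\<in>Pow {..<m}. cube_char s a * cube_char s b) = 2 ^ m * of_bool (b = a)"
proof -
  define f :: "nat \<Rightarrow> complex" where "f k = (if bit a k = bit b k then 1 else -1)" for k
  have "cube_char s a * cube_char s b = prod f s" for s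
    by (auto simp: cube_char_def f_def prod.distrib[symmetric] intro!: prod.cong)
  then have "(\<Sum>s\<in>Pow {..<m}. cube_char s a * cube_char s b) = (\<Prod>k<m. f k + 1)"
    by (subst prod_add) auto
  also have "\<dots> = 2 ^ m * of_bool (b = a)"
  proof (cases "a = b")
    case True
    then show ?thesis by (simp add: f_def)
  next
    case False
    then obtain k where "k < m" "bit a k \<noteq> bit b k"
      using eq_iff_bits_below assms by blast
    then have "f k + 1 = 0" "k \<in> {..<m}"
      by (auto simp: f_def)
    then have "(\<Prod>k<m. f k + 1) = 0"
      by (metis prod_zero finite_lessThan)
    then show ?thesis using False by simp
  qed
  finally show ?thesis .
qed

lemma cube_mat_entry:
  assumes "i < 2 ^ m" "l < 2 ^ m"
  shows "cube_mat m $$ (i, l) = of_bool (\<exists>!k. bit i k \<noteq> bit l k)"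
proof -
  have "{i + 1, l + 1} \<in> {{a, b} | a b. a \<in> {1..2 ^ m} \<and> b \<in> {1..2 ^ m} \<and>
        (\<exists>!k. bit (a - 1) k \<noteq> bit (b - 1) k)} \<longleftrightarrow> (\<exists>!k. bit i k \<noteq> bit l k)" (is "?L \<longleftrightarrow> ?R")
  proof
    assume ?L
    then show ?R
      by (auto simp: doubleton_eq_iff) (metis+)?
  next
    assume ?R
    moreover have "i + 1 \<in> {1..2 ^ m}" "l + 1 \<in> {1..2 ^ m}"
      using assms by auto
    moreover have "i + 1 - 1 = i" "l + 1 - 1 = l"
      by simp_all
    ultimately show ?L
      by (smt (verit, ccfv_threshold) mem_Collect_eq)
  qed
  then show ?thesis
    using assms by (simp add: cube_mat_def adj_mat_def)
qed

lemma cube_neighbours: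
  fixes l :: nat
  assumes "l < 2 ^ m"
  shows "{i \<in> {..<2 ^ m}. \<exists>!k. bit i k \<noteq> bit l k} = (\<lambda>k. flip_bit k l) ` {..<m}"
proof (intro subset_antisym subsetI)
  fix i :: nat assume "i \<in> {i \<in> {..<2 ^ m}. \<exists>!k. bit i k \<noteq> bit l k}"
  then obtain k where i: "i < 2 ^ m" and k: "bit i k \<noteq> bit l k" "\<And>k'. bit i k' \<noteq> bit l k' \<Longrightarrow> k' = k"
    by blast
  have "k < m"
    using k(1) bit_less_exp_nat[OF _ i] bit_less_exp_nat[OF _ assms] by (cases "bit i k") auto
  moreover have "i = flip_bit k l"
  proof (rule bit_eqI)
    fix k'
    show "bit i k' = bit (flip_bit k l) k'"
      using k(1) k(2)[of k'] by (auto simp: bit_flip_bit_iff)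
  qed
  ultimately show "i \<in> (\<lambda>k. flip_bit k l) ` {..<m}"
    by blast
next
  fix i :: nat assume "i \<in> (\<lambda>k. flip_bit k l) ` {..<m}"
  then obtain k where k: "k < m" "i = flip_bit k l"
    by blast
  have bit_i: "bit i k' \<longleftrightarrow> (if k' = k then \<not> bit l k' else bit l k')" for k'
    using k by (auto simp: bit_flip_bit_iff)
  have "k' < m" if "bit i k'" for k'
    using that k(1) bit_less_exp_nat[OF _ assms, of k'] unfolding bit_i by (auto split: if_splits)
  \<comment> \<open>All set bits lie below \<open>m\<close>, so truncation to \<open>m\<close> bits
    changes nothing, and this bounds \<open>i\<close>.\<close>
  then have "take_bit m i = i"
    unfolding bit_eq_iff bit_take_bit_iff by blast
  then have "i < 2 ^ m"
    by (metis take_bit_nat_less_exp)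
  have "bit i k' \<noteq> bit l k' \<longleftrightarrow> k' = k" for k'
    unfolding bit_i by simp
  then have "\<exists>!k. bit i k \<noteq> bit l k"
    by (intro ex1I[of _ k]) blast+
  with \<open>i < 2 ^ m\<close> show "i \<in> {i \<in> {..<2 ^ m}. \<exists>!k. bit i k \<noteq> bit l k}"
    by blast
qed

lemma cube_char_flip_bit:
  assumes "finite s"
  shows "cube_char s (flip_bit k l) = (if k \<in> s then -1 else 1) * cube_char s l"
proof -
  have off: "(\<Prod>j\<in>s - {k}. if bit (flip_bit k l) j then -1 else 1 :: complex) =
      (\<Prod>j\<in>s - {k}. if bit l j then -1 else 1)"
    by (intro prod.cong) (auto simp: bit_flip_bit_iff)
  show ?thesis
  proof (cases "k \<in> s")
    case True
    then show ?thesis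
      unfolding cube_char_def using assms off
      by (simp add: prod.remove[OF assms True] bit_flip_bit_iff)
  next
    case False
    then have "s - {k} = s" by simp
    with off False show ?thesis
      unfolding cube_char_def by simp
  qed
qed

text \<open>Flipping a bit in \<open>s\<close> negates the character and flipping any other bit
  fixes it, so the \<open>m\<close> neighbours contribute \<open>card s\<close> minus signs and
  \<open>m - card s\<close> plus signs.\<close>

lemma cube_char_eigenvector:
  assumes "s \<subseteq> {..<m}" "l < 2 ^ m"
  shows "(\<Sum>i<2 ^ m. cube_char s i * cube_mat m $$ (i, l)) =
    (of_nat m - 2 * of_nat (card s)) * cube_char s l"
proof -
  have fin: "finite s"
    using assms finite_subset by blast
  have inj: "inj_on (\<lambda>k. flip_bit k l) {..<m}"
  proof (rule inj_onI)
    fix k k' assume "flip_bit k l = flip_bit k' l"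
    then have "bit (flip_bit k l) k = bit (flip_bit k' l) k"
      by simp
    then show "k = k'"
      by (auto simp: bit_flip_bit_iff)
  qed
  have "(\<Sum>i<2 ^ m. cube_char s i * cube_mat m $$ (i, l)) =
      (\<Sum>i\<in>{i \<in> {..<2 ^ m}. \<exists>!k. bit i k \<noteq> bit l k}. cube_char s i)"
    unfolding sum.inter_filter[OF finite_lessThan]
  proof (rule sum.cong[OF refl])
    fix i :: nat assume "i \<in> {..<2 ^ m}"
    moreover have "x * of_bool P = (if P then x else 0)" for x :: complex and P
      by simp
    ultimately show "cube_char s i * cube_mat m $$ (i, l) =
        (if \<exists>!k. bit i k \<noteq> bit l k then cube_char s i else 0)"
      by (simp only: cube_mat_entry[OF _ assms(2)] lessThan_iff)
  qed
  also have "\<dots> = (\<Sum>k<m. cube_char s (flip_bit k l))"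
    unfolding cube_neighbours[OF assms(2)] using inj by (simp add: sum.reindex)
  also have "\<dots> = (\<Sum>k<m. if k \<in> s then -1 else 1) * cube_char s l"
    unfolding cube_char_flip_bit[OF fin] sum_distrib_right ..
  also have "(\<Sum>k<m. if k \<in> s then -1 else 1 :: complex) = of_nat m - 2 * of_nat (card s)"
  proof -
    have "(\<Sum>k<m. if k \<in> s then -1 else 1 :: complex) = (\<Sum>k<m. 1 - (if k \<in> s then 2 else 0))"
      by (intro sum.cong) auto
    also have "\<dots> = of_nat m - (\<Sum>k\<in>{..<m} \<inter> s. 2)"
      unfolding sum_subtractf sum.inter_restrict[OF finite_lessThan] by simp
    also have "{..<m} \<inter> s = s"
      using assms by blast
    finally show ?thesis by simp
  qed
  finally show ?thesis .
qed

text \<open>Subtraction from an all-ones number never borrows. The induction strips the lowest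
  bit.\<close>

lemma bit_complement_nat:
  "a < 2 ^ m \<Longrightarrow> k < m \<Longrightarrow> bit (2 ^ m - 1 - a :: nat) k \<longleftrightarrow> \<not> bit a k"
proof (induction m arbitrary: a k)
  case (Suc m)
  show ?case
  proof (cases k)
    case 0
    have "even (2 ^ Suc m - 1 - a) \<longleftrightarrow> odd a"
      using Suc.prems by (auto simp: even_diff_nat)
    then show ?thesis
      using 0 by (simp add: bit_0)
  next
    case (Suc k')
    have "(2 ^ Suc m - 1 - a) div 2 = 2 ^ m - 1 - a div 2"
      using Suc.prems by simp
    moreover have "bit (2 ^ m - 1 - a div 2) k' \<longleftrightarrow> \<not> bit (a div 2) k'"
      using Suc Suc.IH Suc.prems by simp
    ultimately show ?thesis
      using Suc by (simp add: bit_Suc)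
  qed
qed simp

text \<open>At each position in \<open>s\<close> exactly one of the two numbers has its bit set, so
  each pair of factors gives -1.\<close>

lemma cube_char_complement:
  assumes "s \<subseteq> {..<m}" "a < 2 ^ m"
  shows "cube_char s a * cube_char s (2 ^ m - 1 - a) = (- 1) ^ card s"
proof -
  have "cube_char s a * cube_char s (2 ^ m - 1 - a) = (\<Prod>k\<in>s. - 1)"
    unfolding cube_char_def prod.distrib[symmetric]
    by (intro prod.cong refl) (use assms bit_complement_nat in \<open>auto simp: subset_iff\<close>)
  then show ?thesis by simp
qed

section \<open>Layers of the 4-cube and of the switched 4-cube\<close>

text \<open>The distance from vertex 1 in both graphs; index \<open>i\<close> stands for vertex
  \<open>i + 1\<close>.\<close>

definition layer :: "nat \<Rightarrow> nat" where
  "layer i = (if i = 0 then 0 else if i \<le> 4 then 1 else if i \<le> 10 then 2 else if i \<le> 14 then 3 else 4)"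

lemma less_16_cases:
  fixes l :: nat
  assumes "l < 16"
  shows "l = 0 \<or> l = 1 \<or> l = 2 \<or> l = 3 \<or> l = 4 \<or> l = 5 \<or> l = 6 \<or> l = 7 \<or> l = 8 \<or> l = 9 \<or>
    l = 10 \<or> l = 11 \<or> l = 12 \<or> l = 13 \<or> l = 14 \<or> l = 15"
  using assms by presburger

lemma sum_less_16:
  fixes f :: "nat \<Rightarrow> 'a::comm_monoid_add"
  shows "(\<Sum>i<16. f i) = f 0 + f 1 + f 2 + f 3 + f 4 + f 5 + f 6 + f 7 + f 8 + f 9 + f 10 + f 11 +
    f 12 + f 13 + f 14 + f 15"
  by (simp add: numeral_eq_Suc lessThan_Suc add_ac)

text \<open>Checked at each of the 16 vertices for arbitrary \<open>g\<close>. The truncated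
  \<open>layer l - 1\<close> at layer 0 and the value \<open>g 5\<close> at layer 4 both get weight
  0.\<close>

lemma A41_equitable:
  assumes "l < 16"
  shows "(\<Sum>i<16. g (layer i) * A41 $$ (i, l)) =
    of_nat (layer l) * g (layer l - 1) + of_nat (4 - layer l) * g (layer l + 1)"
  using less_16_cases[OF assms]
  by (elim disjE; simp add: sum_less_16 A41_def adj_mat_def edges_common_def doubleton_eq_iff layer_def flip: numeral_2_eq_2)

text \<open>Switching replaces the edges between layers 1 and 2 by their bipartite complement. Each
  vertex of one of these layers is joined to exactly half of the other, so all neighbour counts
  survive.\<close>

lemma A42_equitable:
  assumes "l < 16"
  shows "(\<Sum>i<16. g (layer i) * A42 $$ (i, l)) =
    of_nat (layer l) * g (layer l - 1) + of_nat (4 - layer l) * g (layer l + 1)"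
  using less_16_cases[OF assms]
  by (elim disjE; simp add: sum_less_16 A42_def adj_mat_def edges_common_def doubleton_eq_iff layer_def flip: numeral_2_eq_2)

text \<open>For \<open>l \<le> 4\<close>, the coefficient of y^d in (1 - y)^l (1 + y)^(4 - l), or
  the sum of all weight \<open>d\<close> characters of the 4-cube at a point of weight
  \<open>l\<close>.\<close>

definition krawtchouk :: "nat \<Rightarrow> nat \<Rightarrow> complex" where
  "krawtchouk d l = (\<Sum>j\<le>d. (- 1) ^ j * of_nat (l choose j) * of_nat ((4 - l) choose (d - j)))"

lemma less_5_cases:
  fixes l :: nat
  assumes "l < 5"
  shows "l = 0 \<or> l = 1 \<or> l = 2 \<or> l = 3 \<or> l = 4"
  using assms by presburger

text \<open>The eigenvalue equation of a sum of weight \<open>d\<close> characters of the 4-cube,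
  read on layers; the 25 cases are evaluated directly.\<close>

lemma krawtchouk_recurrence:
  assumes "d < 5" "l < 5"
  shows "of_nat l * krawtchouk d (l - 1) + of_nat (4 - l) * krawtchouk d (l + 1) =
    (4 - 2 * of_nat d) * krawtchouk d l"
  using less_5_cases[OF assms(1)] less_5_cases[OF assms(2)]
  by (elim disjE; simp add: krawtchouk_def numeral_eq_Suc)

lemma layer_less_5: "layer i < 5"
  by (simp add: layer_def)

lemma switched_block_eigenvector:
  assumes "B = A41 \<or> B = A42" "d < 5" "l < 16"
  shows "(\<Sum>i<16. krawtchouk d (layer i) * B $$ (i, l)) =
    (4 - 2 * of_nat d) * krawtchouk d (layer l)"
  using assms A41_equitable[of l "krawtchouk d"] A42_equitable[of l "krawtchouk d"]
    krawtchouk_recurrence[OF assms(2) layer_less_5] by auto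

text \<open>The ratio K_d(layer x) / K_d(0) at the two end vertices, indices 0 and 15.\<close>

definition end_sign :: "nat \<Rightarrow> nat \<Rightarrow> complex" where
  "end_sign x d = (if x = 0 then 1 else (- 1) ^ d)"

text \<open>At y = 1 the polynomial (1 - y)^l (1 + y)^(4 - l) is 16 for l = 0 and 0 for the other
  layers; at y = -1 the same holds with l = 4.\<close>

lemma krawtchouk_ends:
  assumes "x = 0 \<or> x = 15" "i < 16"
  shows "(\<Sum>d<5. end_sign x d * krawtchouk d (layer i)) = 16 * of_bool (i = x)"
proof -
  have "(\<Sum>d<5. krawtchouk d l) = 16 * of_bool (l = 0)"
    "(\<Sum>d<5. (- 1) ^ d * krawtchouk d l) = 16 * of_bool (l = 4)" if "l < 5" for l
    using less_5_cases[OF that] by (elim disjE; simp add: krawtchouk_def numeral_eq_Suc)+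
  note * = this[OF layer_less_5[of i]]
  \<comment> \<open>Layers 0 and 4 are singletons, so their indicators are unit vectors.\<close>
  have "layer i = 0 \<longleftrightarrow> i = 0" "layer i = 4 \<longleftrightarrow> i = 15"
    using assms(2) by (auto simp: layer_def split: if_splits)
  with assms(1) * show ?thesis
    by (auto simp: end_sign_def)
qed

text \<open>Follows from K_d(0) = C(4, d) and K_d(4) = (-1)^d C(4, d). The same sign appears for
  both ends.\<close>

lemma end_sign_antipode:
  assumes "x = 0 \<or> x = 15" "d < 5"
  shows "end_sign x d * krawtchouk d (layer (15 - x)) = (- 1) ^ d * of_nat (4 choose d)"
  using assms(1) less_5_cases[OF assms(2)]
  by (elim disjE; simp add: end_sign_def krawtchouk_def layer_def numeral_eq_Suc)

section \<open>Cubes assembled from 16-vertex blocks\<close>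

text \<open>A common form for the n-cube and its switched variants: index \<open>i\<close> is
  position \<open>i mod 16\<close> in block \<open>i div 16\<close>, and \<open>F q\<close> is the
  graph inside block \<open>q\<close>.\<close>

definition block_cube :: "nat \<Rightarrow> (nat \<Rightarrow> complex mat) \<Rightarrow> complex mat" where
  "block_cube m F = mat (2 ^ m * 16) (2 ^ m * 16) (\<lambda>(i, l).
     of_bool (i div 16 = l div 16) * F (i div 16) $$ (i mod 16, l mod 16) +
     cube_mat m $$ (i div 16, l div 16) * of_bool (i mod 16 = l mod 16))"

lemma sum_blocks:
  fixes f :: "nat \<Rightarrow> nat \<Rightarrow> 'a::comm_monoid_add"
  shows "(\<Sum>i<M * 16. f (i div 16) (i mod 16)) = (\<Sum>q<M. \<Sum>r<16. f q r)"
proof -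
  have "(\<Sum>r<16. f q r) = (\<Sum>i\<in>{q * 16..<q * 16 + 16}. f (i div 16) (i mod 16))" for q
  proof (rule sum.reindex_bij_witness[of _ "\<lambda>i. i mod 16" "\<lambda>r. q * 16 + r"])
    fix i assume "i \<in> {q * 16..<q * 16 + 16}"
    then have "i div 16 = q"
      by (intro div_nat_eqI) auto
    then show "q * 16 + i mod 16 = i"
      using div_mult_mod_eq[of i 16] by simp
  qed auto
  then show ?thesis
    by (simp add: sum.nat_group)
qed

text \<open>The block term acts only on the Krawtchouk factor, with eigenvalue
  \<open>4 - 2 * d\<close> for either kind of block; the cube term acts only on the character. The
  eigenvalues add, whatever \<open>F\<close> chooses.\<close>

lemma block_cube_eigenvector:
  assumes F: "\<And>q. q < 2 ^ m \<Longrightarrow> F q = A41 \<or> F q = A42"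
    and s: "s \<subseteq> {..<m}" and d: "d < 5" and l: "l < 2 ^ m * 16"
  shows "(\<Sum>i<2 ^ m * 16. cube_char s (i div 16) * krawtchouk d (layer (i mod 16)) *
      block_cube m F $$ (i, l)) =
    (of_nat m + 4 - 2 * of_nat (card s) - 2 * of_nat d) *
      (cube_char s (l div 16) * krawtchouk d (layer (l mod 16)))"
proof -
  define p where "p = l div 16"
  define y where "y = l mod 16"
  have p: "p < 2 ^ m" and y: "y < 16"
    using l by (auto simp: p_def y_def less_mult_imp_div_less)
  let ?k = "\<lambda>r. krawtchouk d (layer r)"
  have "(\<Sum>i<2 ^ m * 16. cube_char s (i div 16) * ?k (i mod 16) * block_cube m F $$ (i, l)) =
      (\<Sum>i<2 ^ m * 16. (\<lambda>q r. cube_char s q * ?k r *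
        (of_bool (q = p) * F q $$ (r, y) + cube_mat m $$ (q, p) * of_bool (r = y)))
        (i div 16) (i mod 16))"
    by (rule sum.cong) (use l in \<open>auto simp: block_cube_def p_def y_def\<close>)
  also have "\<dots> = (\<Sum>q<2 ^ m. \<Sum>r<16. cube_char s q * ?k r *
        (of_bool (q = p) * F q $$ (r, y) + cube_mat m $$ (q, p) * of_bool (r = y)))"
    by (rule sum_blocks)
  also have "\<dots> = (\<Sum>q<2 ^ m. of_bool (q = p) * (cube_char s q * (\<Sum>r<16. ?k r * F q $$ (r, y))) +
      cube_char s q * cube_mat m $$ (q, p) * (\<Sum>r<16. of_bool (r = y) * ?k r))"
  proof (intro sum.cong refl)
    fix q
    have "(\<Sum>r<16. c * ?k r * (u * f r + v * h r)) =
        u * (c * (\<Sum>r<16. ?k r * f r)) + c * v * (\<Sum>r<16. h r * ?k r)" for c u v f h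
      by (simp add: sum_distrib_left sum.distrib algebra_simps)
    then show "(\<Sum>r<16. cube_char s q * ?k r *
        (of_bool (q = p) * F q $$ (r, y) + cube_mat m $$ (q, p) * of_bool (r = y))) =
      of_bool (q = p) * (cube_char s q * (\<Sum>r<16. ?k r * F q $$ (r, y))) +
      cube_char s q * cube_mat m $$ (q, p) * (\<Sum>r<16. of_bool (r = y) * ?k r)" .
  qed
  also have "\<dots> = cube_char s p * (\<Sum>r<16. ?k r * F p $$ (r, y)) +
      (\<Sum>q<2 ^ m. cube_char s q * cube_mat m $$ (q, p)) * ?k y"
  proof -
    have delta: "(\<Sum>q<N. of_bool (q = p) * h q) = h p" if "p < N"
      for h :: "nat \<Rightarrow> complex" and p N
    proof -
      have "(\<Sum>q<N. of_bool (q = p) * h q) = (\<Sum>q<N. if q = p then h q else 0)"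
        by (intro sum.cong) auto
      then show ?thesis
        using that by simp
    qed
    show ?thesis
      by (simp only: sum.distrib delta[OF p] delta[OF y] sum_distrib_right)
  qed
  also have "\<dots> = (of_nat m + 4 - 2 * of_nat (card s) - 2 * of_nat d) * (cube_char s p * ?k y)"
    unfolding switched_block_eigenvector[OF F[OF p] d y] cube_char_eigenvector[OF s p]
    by (simp add: algebra_simps)
  finally show ?thesis
    by (simp add: p_def y_def)
qed

text \<open>\<open>F\<close> is absent from the right-hand side: the rows at the first and last
  position of a block are the same for every choice of blocks.\<close>

lemma mat_exp_block_cube:
  assumes F: "\<And>q. q < 2 ^ m \<Longrightarrow> F q = A41 \<or> F q = A42"
    and x: "x = 0 \<or> x = 15" and a: "a < 2 ^ m" and k: "k < 2 ^ m * 16"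
  shows "mat_exp (z \<cdot>\<^sub>m block_cube m F) $$ (16 * a + x, k) =
    (\<Sum>(s, d)\<in>Pow {..<m} \<times> {..<5}. cube_char s a * end_sign x d / (2 ^ m * 16) *
      (cube_char s (k div 16) * krawtchouk d (layer (k mod 16))) *
      exp (z * (of_nat m + 4 - 2 * of_nat (card s) - 2 * of_nat d)))"
proof -
  \<comment> \<open>The unit vector is a tensor product, so its expansion is the product of the
    character and Krawtchouk expansions; their constants \<open>2 ^ m\<close> and 16 give the
    denominator.\<close>
  have decomp: "(\<Sum>(s, d)\<in>Pow {..<m} \<times> {..<5}. cube_char s a * end_sign x d / (2 ^ m * 16) *
      (cube_char s (i div 16) * krawtchouk d (layer (i mod 16)))) = of_bool (i = 16 * a + x)"
    if i: "i < 2 ^ m * 16" for i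
  proof -
    have "(\<Sum>(s, d)\<in>Pow {..<m} \<times> {..<5}. cube_char s a * end_sign x d / (2 ^ m * 16) *
        (cube_char s (i div 16) * krawtchouk d (layer (i mod 16)))) =
        (\<Sum>s\<in>Pow {..<m}. cube_char s a * cube_char s (i div 16)) *
        (\<Sum>d<5. end_sign x d * krawtchouk d (layer (i mod 16))) / (2 ^ m * 16)"
      by (simp add: sum.cartesian_product[symmetric] sum_product sum_divide_distrib mult_ac)
    also have "\<dots> = of_bool (i div 16 = a) * of_bool (i mod 16 = x)"
      using i by (simp add: cube_char_orthogonal[OF a] krawtchouk_ends[OF x] less_mult_imp_div_less)
    also have "\<dots> = of_bool (i = 16 * a + x)"
    proof -
      have "i div 16 = a \<and> i mod 16 = x \<longleftrightarrow> i = 16 * a + x"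
      proof
        show "i = 16 * a + x" if "i div 16 = a \<and> i mod 16 = x"
          using that mult_div_mod_eq[of 16 i] by metis
      qed (use x in auto)
      then show ?thesis
        by (simp flip: of_bool_conj)
    qed
    finally show ?thesis .
  qed
  have j: "16 * a + x < 2 ^ m * 16"
    using a x by auto
  have "mat_exp (z \<cdot>\<^sub>m block_cube m F) $$ (16 * a + x, k) =
      (\<Sum>r\<in>Pow {..<m} \<times> {..<5}. cube_char (fst r) a * end_sign x (snd r) / (2 ^ m * 16) *
      (cube_char (fst r) (k div 16) * krawtchouk (snd r) (layer (k mod 16))) *
      exp (z * (of_nat m + 4 - 2 * of_nat (card (fst r)) - 2 * of_nat (snd r))))"
  proof (rule mat_exp_spectral[OF _ j k, where v = "\<lambda>r i. cube_char (fst r) (i div 16) *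
        krawtchouk (snd r) (layer (i mod 16))"])
    show "block_cube m F \<in> carrier_mat (2 ^ m * 16) (2 ^ m * 16)"
      by (simp add: block_cube_def)
    show "(\<Sum>i<2 ^ m * 16. cube_char (fst r) (i div 16) * krawtchouk (snd r) (layer (i mod 16)) *
        block_cube m F $$ (i, l)) =
      (of_nat m + 4 - 2 * of_nat (card (fst r)) - 2 * of_nat (snd r)) *
        (cube_char (fst r) (l div 16) * krawtchouk (snd r) (layer (l mod 16)))"
      if "r \<in> Pow {..<m} \<times> {..<5}" "l < 2 ^ m * 16" for r l
      using that by (intro block_cube_eigenvector F) auto
    show "(\<Sum>r\<in>Pow {..<m} \<times> {..<5}. cube_char (fst r) a * end_sign x (snd r) / (2 ^ m * 16) *
        (cube_char (fst r) (i div 16) * krawtchouk (snd r) (layer (i mod 16)))) =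
      of_bool (i = 16 * a + x)" if "i < 2 ^ m * 16" for i
      using decomp[OF that] by (simp add: case_prod_beta)
  qed
  then show ?thesis
    by (simp add: case_prod_beta)
qed

lemma block_cube_antipode:
  assumes F: "\<And>q. q < 2 ^ m \<Longrightarrow> F q = A41 \<or> F q = A42"
    and x: "x = 0 \<or> x = 15" and a: "a < 2 ^ m"
  shows "mat_exp (\<i> * complex_of_real (pi / 2) \<cdot>\<^sub>m block_cube m F) $$
    (16 * a + x, 16 * (2 ^ m - 1 - a) + (15 - x)) = \<i> ^ (m + 4)"
proof -
  define b where "b = 2 ^ m - 1 - a"
  \<comment> \<open>Each unit of \<open>m + 4\<close> contributes exp(i pi/2) = i, and each
    eigenvalue drop of 2 contributes exp(-i pi) = -1.\<close>
  have phase: "exp (\<i> * complex_of_real (pi / 2) * (of_nat m + 4 - 2 * of_nat c - 2 * of_nat d)) =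
      \<i> ^ (m + 4) * (- 1) ^ c * (- 1) ^ d" for c d :: nat
  proof -
    have "exp (\<i> * complex_of_real (pi / 2) * (of_nat m + 4 - 2 * of_nat c - 2 * of_nat d)) =
        exp (of_nat (m + 4) * (\<i> * complex_of_real (pi / 2))) *
        (exp (of_nat c * - (\<i> * pi)) * exp (of_nat d * - (\<i> * pi)))"
      unfolding exp_add[symmetric] by (simp add: algebra_simps)
    also have "\<dots> = exp (\<i> * complex_of_real (pi / 2)) ^ (m + 4) *
        (exp (- (\<i> * pi)) ^ c * exp (- (\<i> * pi)) ^ d)"
      unfolding exp_of_nat_mult ..
    also have "exp (\<i> * complex_of_real (pi / 2)) = \<i>"
      by (metis cis_conv_exp cis_pi_half)
    also have "exp (- (\<i> * complex_of_real pi)) = - 1"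
      by (simp add: exp_minus)
    finally show ?thesis by simp
  qed
  have "16 * b + (15 - x) < 2 ^ m * 16"
    using a x by (auto simp: b_def)
  then have "mat_exp (\<i> * complex_of_real (pi / 2) \<cdot>\<^sub>m block_cube m F) $$
    (16 * a + x, 16 * b + (15 - x)) =
    (\<Sum>(s, d)\<in>Pow {..<m} \<times> {..<5}. cube_char s a * end_sign x d / (2 ^ m * 16) *
      (cube_char s b * krawtchouk d (layer (15 - x))) *
      (\<i> ^ (m + 4) * (- 1) ^ card s * (- 1) ^ d))"
    using x by (subst mat_exp_block_cube[OF F x a]) (simp_all only: phase, auto)
  \<comment> \<open>The values at the antipode carry the signs (-1)^(card s) and (-1)^d, exactly
    those of the phase. They square to 1, and the terms add without cancellation.\<close>
  also have "\<dots> = (\<Sum>(s, d)\<in>Pow {..<m} \<times> {..<5}. \<i> ^ (m + 4) / (2 ^ m * 16) * of_nat (4 choose d))"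
  proof (rule sum.cong, goal_cases)
    case (2 r)
    obtain s d where r: "r = (s, d)" "s \<subseteq> {..<m}" "d < 5"
      using 2 by auto
    have sq: "(- 1 :: complex) ^ c * (- 1) ^ c = 1" for c :: nat
      by (simp flip: power_add)
    have "cube_char s a * end_sign x d / (2 ^ m * 16) *
      (cube_char s b * krawtchouk d (layer (15 - x))) * (\<i> ^ (m + 4) * (- 1) ^ card s * (- 1) ^ d) =
      (cube_char s a * cube_char s b) * (- 1) ^ card s *
      ((end_sign x d * krawtchouk d (layer (15 - x))) * (- 1) ^ d) * (\<i> ^ (m + 4) / (2 ^ m * 16))"
      by (simp add: mult_ac)
    also have "\<dots> = ((- 1) ^ card s * (- 1) ^ card s) * ((- 1) ^ d * (- 1) ^ d) *
        (\<i> ^ (m + 4) / (2 ^ m * 16) * of_nat (4 choose d))"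
      unfolding b_def cube_char_complement[OF r(2) a] end_sign_antipode[OF x r(3)]
      by (simp only: mult_ac)
    finally show ?case
      using r by (simp add: sq)
  qed simp
  also have "\<dots> = \<i> ^ (m + 4) / (2 ^ m * 16) * (\<Sum>s\<in>Pow {..<m}. \<Sum>d<5. of_nat (4 choose d))"
    by (simp add: sum.cartesian_product[symmetric] sum_distrib_left del: sum_constant)
  \<comment> \<open>The binomials sum to 2^4 over \<open>d\<close>, and there are
    \<open>2 ^ m\<close> sets \<open>s\<close>, which cancels the denominator.\<close>
  also have "(\<Sum>d<5. of_nat (4 choose d)) = (16 :: complex)"
    by (simp add: numeral_eq_Suc)
  also have "(\<Sum>s\<in>Pow {..<m}. 16) = (2 ^ m * 16 :: complex)"
    by (simp add: card_Pow)
  finally show ?thesis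
    by (simp add: b_def)
qed

section \<open>The n-cube and the partially switched cubes in block form\<close>

lemma diag_block_mat_entry:
  fixes Bs :: "'a::zero mat list"
  assumes "set Bs \<subseteq> carrier_mat b b" "i < length Bs * b" "l < length Bs * b"
  shows "diag_block_mat Bs $$ (i, l) =
    (if i div b = l div b then (Bs ! (i div b)) $$ (i mod b, l mod b) else 0)"
  using assms
proof (induction Bs arbitrary: i l)
  case (Cons B Bs)
  have b: "b > 0"
    using Cons.prems(2) by (cases b) auto
  have "sum_list (map dim_row Bs) = length Bs * b" "sum_list (map dim_col Bs) = length Bs * b"
    using Cons.prems(1) by (induction Bs) auto
  then have dims: "dim_row (diag_block_mat Bs) = length Bs * b" "dim_col (diag_block_mat Bs) = length Bs * b"
    by (simp_all add: dim_diag_block_mat)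
  have B: "B \<in> carrier_mat b b"
    using Cons.prems by simp
  \<comment> \<open>Beyond the first block, shifting by \<open>b\<close> lowers the block number by
    one and keeps the position, as the induction hypothesis for the tail requires.\<close>
  have div_b: "i div b = (if i < b then 0 else Suc ((i - b) div b))"
    "i mod b = (if i < b then i else (i - b) mod b)" for i
    using b by (auto simp: le_div_geq le_mod_geq not_less)
  show ?case
  proof (cases "i < b \<or> l < b")
    case True
    then show ?thesis
      using Cons.prems B dims by (auto simp: Let_def div_b[of i] div_b[of l])
  next
    case False
    then have "diag_block_mat Bs $$ (i - b, l - b) = (if (i - b) div b = (l - b) div b
        then (Bs ! ((i - b) div b)) $$ ((i - b) mod b, (l - b) mod b) else 0)"
      using Cons.prems by (intro Cons.IH) auto
    then show ?thesis
      using Cons.prems B dims False by (auto simp: Let_def div_b[of i] div_b[of l])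
  qed
qed simp

lemma dim_cube_mat: "dim_row (cube_mat m) = 2 ^ m" "dim_col (cube_mat m) = 2 ^ m"
  by (simp_all add: cube_mat_def adj_mat_def)

lemma A41_carrier: "A41 \<in> carrier_mat 16 16" and A42_carrier: "A42 \<in> carrier_mat 16 16"
  by (simp_all add: A41_def A42_def adj_mat_def)

lemma ncube_mat_eq_block_cube: "ncube_mat n = block_cube (n - 4) (\<lambda>_. A41)"
  using A41_carrier
  by (intro eq_matI)
     (auto simp: ncube_mat_def block_cube_def kronecker_def dim_cube_mat less_mult_imp_div_less)

lemma partially_switched_cube_block_cube:
  assumes "partially_switched_cube n A"
  obtains F where "A = block_cube (n - 4) F" "\<And>q. q < 2 ^ (n - 4) \<Longrightarrow> F q = A41 \<or> F q = A42"
proof -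
  obtain Bs where len: "length Bs = 2 ^ (n - 4)" and Bs: "set Bs \<subseteq> {A41, A42}"
    and A: "A = diag_block_mat Bs + kronecker (cube_mat (n - 4)) (1\<^sub>m 16)"
    using assms unfolding partially_switched_cube_def by blast
  have carr: "set Bs \<subseteq> carrier_mat 16 16"
    using Bs A41_carrier A42_carrier by auto
  have "A = block_cube (n - 4) ((!) Bs)"
    by (intro eq_matI)
       (auto simp: A block_cube_def kronecker_def dim_cube_mat less_mult_imp_div_less
          diag_block_mat_entry[OF carr] len)
  then show ?thesis
  proof (rule that)
    show "Bs ! q = A41 \<or> Bs ! q = A42" if "q < 2 ^ (n - 4)" for q
    proof -
      have "Bs ! q \<in> set Bs"
        using that len by simp
      with Bs show ?thesis by blast
    qed
  qed
qed

section \<open>Fidelity and perfect state transfer for block cubes\<close>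

text \<open>Both sides are squared moduli of entries that \<open>mat_exp_block_cube\<close>
  evaluates to the same sum.\<close>

lemma fidelity_block_cube_cong:
  assumes F: "\<And>q. q < 2 ^ m \<Longrightarrow> F q = A41 \<or> F q = A42"
    and G: "\<And>q. q < 2 ^ m \<Longrightarrow> G q = A41 \<or> G q = A42"
    and x: "x = 0 \<or> x = 15" and a: "a < 2 ^ m" and k: "k \<in> {1..2 ^ m * 16}"
  shows "fidelity (block_cube m F) (16 * a + x + 1) k t = fidelity (block_cube m G) (16 * a + x + 1) k t"
proof -
  have dim: "dim_row (block_cube m H) = 2 ^ m * 16" for H
    by (simp add: block_cube_def)
  have "16 * a + x + 1 \<in> {1..2 ^ m * 16}"
    using a x by auto
  note fid = fidelity_eq_entry[OF dim this k]
  have "k - 1 < 2 ^ m * 16"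
    using k by auto
  note entry = mat_exp_block_cube[OF _ x a this]
  show ?thesis
    unfolding fid add_diff_cancel_right' using entry[of F, OF F] entry[of G, OF G] by simp
qed

text \<open>The target is the antipode: complemented block number, opposite end. The entry is a
  power of i, hence of modulus 1.\<close>

lemma PST_block_cube:
  assumes F: "\<And>q. q < 2 ^ m \<Longrightarrow> F q = A41 \<or> F q = A42"
    and x: "x = 0 \<or> x = 15" and a: "a < 2 ^ m"
  shows "PST (block_cube m F) (16 * a + x + 1) (16 * (2 ^ m - 1 - a) + (15 - x) + 1) (pi / 2)"
proof -
  define b :: nat where "b = 2 ^ m - 1 - a"
  have b: "b < 2 ^ m"
    using a by (simp add: b_def)
  have dim: "dim_row (block_cube m F) = 2 ^ m * 16"
    by (simp add: block_cube_def)
  have j: "16 * a + x + 1 \<in> {1..2 ^ m * 16}" and k: "16 * b + (15 - x) + 1 \<in> {1..2 ^ m * 16}"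
    using a b x by auto
  \<comment> \<open>Modulo 16, one label is 1 and the other is 0.\<close>
  have "16 * a + x + 1 \<noteq> 16 * b + (15 - x) + 1"
    using x by presburger
  moreover have "mat_exp (\<i> * complex_of_real (pi / 2) \<cdot>\<^sub>m block_cube m F) $$
      (16 * a + x, 16 * b + (15 - x)) = \<i> ^ (m + 4)"
    unfolding b_def by (rule block_cube_antipode[OF F x a])
  then have "fidelity (block_cube m F) (16 * a + x + 1) (16 * b + (15 - x) + 1) (pi / 2) = 1"
    unfolding fidelity_eq_entry[OF dim j k] add_diff_cancel_right' by (simp add: norm_power)
  ultimately show ?thesis
    unfolding PST_def dim b_def[symmetric] using j k by blast
qed

section \<open>Binary labels and the set S\<close>

lemma sum_from_4:
  fixes f :: "nat \<Rightarrow> nat"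
  shows "(\<Sum>k = 4..<4 + r. 2 ^ k * f k) = 16 * (\<Sum>k<r. 2 ^ k * f (4 + k))"
proof (induction r)
  case (Suc r)
  have "{4..<4 + Suc r} = insert (4 + r) {4..<4 + r}"
    by auto
  then show ?case
    using Suc by (simp add: power_add)
qed simp

text \<open>A digit and its complement sum to 1 in every place, so the two numbers add up to
  \<open>2 ^ r - 1\<close>; both claims are read off this.\<close>

lemma binary_digits:
  fixes f :: "nat \<Rightarrow> nat"
  assumes "\<And>k. k < r \<Longrightarrow> f k \<in> {0, 1}"
  shows "(\<Sum>k<r. 2 ^ k * f k) < 2 ^ r"
    and "(\<Sum>k<r. 2 ^ k * (1 - f k)) = 2 ^ r - 1 - (\<Sum>k<r. 2 ^ k * f k)"
proof -
  have "(\<Sum>k<r. 2 ^ k * f k) + (\<Sum>k<r. 2 ^ k * (1 - f k)) + 1 = 2 ^ r"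
    using assms
  proof (induction r)
    case (Suc r)
    then have "f r = 0 \<or> f r = 1" and "(\<Sum>k<r. 2 ^ k * f k) + (\<Sum>k<r. 2 ^ k * (1 - f k)) + 1 = 2 ^ r"
      by auto
    then show ?case by auto
  qed simp
  then show "(\<Sum>k<r. 2 ^ k * f k) < 2 ^ r"
    and "(\<Sum>k<r. 2 ^ k * (1 - f k)) = 2 ^ r - 1 - (\<Sum>k<r. 2 ^ k * f k)"
    by linarith+
qed

lemma sum_bits_nat:
  fixes a :: nat
  assumes "a < 2 ^ r"
  shows "(\<Sum>k<r. 2 ^ k * of_bool (bit a k)) = a"
proof -
  have "take_bit r a = (\<Sum>k<r. 2 ^ k * of_bool (bit a k))"
    unfolding take_bit_sum by (simp add: push_bit_eq_mult lessThan_atLeast0 mult.commute)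
  then show ?thesis
    using assms by (simp add: take_bit_nat_eq_self)
qed

text \<open>The digits from place 4 upwards spell the block number, so S consists of the first and
  last vertex of every block.\<close>

lemma S_set_eq:
  "S_set (4 + r) = (\<lambda>a. 16 * a + 1) ` {..<2 ^ r} \<union> (\<lambda>a. 16 * a + 16) ` {..<2 ^ r}"
proof (intro subset_antisym subsetI)
  fix v assume "v \<in> S_set (4 + r)"
  then obtain f where f: "\<forall>k\<in>{4..<4 + r}. f k \<in> {0, 1 :: nat}"
    and v: "v = 1 + (\<Sum>k = 4..<4 + r. 2 ^ k * f k) \<or> v = 16 + (\<Sum>k = 4..<4 + r. 2 ^ k * f k)"
    unfolding S_set_def by blast
  have "(\<Sum>k<r. 2 ^ k * f (4 + k)) < 2 ^ r"
    using f by (intro binary_digits) auto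
  with v show "v \<in> (\<lambda>a. 16 * a + 1) ` {..<2 ^ r} \<union> (\<lambda>a. 16 * a + 16) ` {..<2 ^ r}"
    unfolding sum_from_4 by auto
next
  fix v assume "v \<in> (\<lambda>a. 16 * a + 1) ` {..<2 ^ r} \<union> (\<lambda>a. 16 * a + 16) ` {..<2 ^ r :: nat}"
  then obtain a :: nat where a: "a < 2 ^ r" and v: "v = 1 + 16 * a \<or> v = 16 + 16 * a"
    by auto
  \<comment> \<open>The bits of the block number, shifted because label digits start at place
    4.\<close>
  define f :: "nat \<Rightarrow> nat" where "f k = of_bool (bit a (k - 4))" for k
  have "(\<Sum>k = 4..<4 + r. 2 ^ k * f k) = 16 * a"
    unfolding sum_from_4 using sum_bits_nat[OF a] by (simp add: f_def)
  moreover have "f \<in> {m. \<forall>k \<in> {4..<4 + r}. m k \<in> {0, 1}}"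
    by (simp add: f_def)
  ultimately show "v \<in> S_set (4 + r)"
    unfolding S_set_def using v by (intro UN_I[of f]) auto
qed

lemma card_S_set: "card (S_set (4 + r)) = 2 * 2 ^ r"
proof -
  have "16 * a + 1 \<noteq> 16 * b + (16 :: nat)" for a b
    by presburger
  then have "(\<lambda>a. 16 * a + 1) ` {..<2 ^ r} \<inter> (\<lambda>a. 16 * a + 16) ` {..<2 ^ r :: nat} = {}"
    by blast
  then show ?thesis
    unfolding S_set_eq by (subst card_Un_disjoint) (auto simp: card_image inj_on_def)
qed

section \<open>Antipodal transfer in partially switched cubes\<close>

theorem theorem4:
  fixes n :: nat and A :: "complex mat"
  assumes "n > 4" and "partially_switched_cube n A"
  shows "(\<exists>P \<subseteq> {1..2 ^ n}. real (card P) \<ge> (1 / 8) * real (2 ^ n) \<and> pairs_up_PST A P (pi / 2)) \<and>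
    (\<forall>m :: nat \<Rightarrow> nat. (\<forall>k \<in> {4..<n}. m k \<in> {0, 1}) \<longrightarrow>
       PST A (1 + (\<Sum>k = 4..<n. 2 ^ k * m k)) (16 + (\<Sum>k = 4..<n. 2 ^ k * (1 - m k))) (pi / 2)) \<and>
    S_set n \<subseteq> {1..2 ^ n} \<and> real (card (S_set n)) \<ge> (1 / 8) * real (2 ^ n) \<and>
    pairs_up_PST A (S_set n) (pi / 2) \<and>
    (\<forall>j \<in> S_set n. \<forall>k \<in> {1..2 ^ n}. \<forall>t :: real.
       fidelity A j k t = fidelity (ncube_mat n) j k t)"
proof -
  define r where "r = n - 4"
  have n: "n = 4 + r"
    using assms(1) by (simp add: r_def)
  then have N: "2 ^ n = 2 ^ r * (16 :: nat)"
    by (simp add: power_add)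
  obtain F where A: "A = block_cube r F" and F: "\<And>q. q < 2 ^ r \<Longrightarrow> F q = A41 \<or> F q = A42"
    using partially_switched_cube_block_cube[OF assms(2)] unfolding r_def by blast
  have S_cases: "\<exists>a x. a < 2 ^ r \<and> (x = 0 \<or> x = 15) \<and> v = 16 * a + x + 1" if "v \<in> S_set n" for v
    using that unfolding n S_set_eq by force
  have S_mem: "16 * a + x + 1 \<in> S_set n" if "a < 2 ^ r" "x = 0 \<or> x = 15" for a x
    using that unfolding n S_set_eq by auto
  have sub: "S_set n \<subseteq> {1..2 ^ n}"
    unfolding N using S_cases by force
  \<comment> \<open>Two of the 16 vertices of each block lie in S, exactly one eighth.\<close>
  have card: "real (card (S_set n)) \<ge> (1 / 8) * real (2 ^ n)"
    unfolding n card_S_set by (simp add: power_add)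
  have pairs: "pairs_up_PST A (S_set n) (pi / 2)"
    unfolding pairs_up_PST_def
  \<comment> \<open>On indices this map complements all \<open>n\<close> bits: it is the antipodal
    involution, swapping the two ends and complementing the block number.\<close>
  proof (intro exI[of _ "\<lambda>v. 2 ^ n + 1 - v"] ballI)
    fix v assume "v \<in> S_set n"
    then obtain a x where a: "a < 2 ^ r" and x: "x = 0 \<or> x = 15" and v: "v = 16 * a + x + 1"
      using S_cases by blast
    have \<sigma>: "2 ^ n + 1 - v = 16 * (2 ^ r - 1 - a) + (15 - x) + 1" (is "_ = ?w")
      using a x unfolding v N by auto
    have "?w \<in> S_set n"
      using a x by (intro S_mem) auto
    moreover have "2 ^ n + 1 - (2 ^ n + 1 - v) = v"
      using sub \<open>v \<in> S_set n\<close> by auto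
    moreover have "PST A v ?w (pi / 2)"
      unfolding A v by (rule PST_block_cube[OF F x a])
    ultimately show "2 ^ n + 1 - v \<in> S_set n \<and> 2 ^ n + 1 - (2 ^ n + 1 - v) = v \<and>
        PST A v (2 ^ n + 1 - v) (pi / 2)"
      unfolding \<sigma> by blast
  qed
  have pst: "PST A (1 + (\<Sum>k = 4..<n. 2 ^ k * m k)) (16 + (\<Sum>k = 4..<n. 2 ^ k * (1 - m k))) (pi / 2)"
    if m: "\<forall>k \<in> {4..<n}. m k \<in> {0, 1}" for m :: "nat \<Rightarrow> nat"
  proof -
    define a where "a = (\<Sum>k<r. 2 ^ k * m (4 + k))"
    have digits: "m (4 + k) \<in> {0, 1}" if "k < r" for k
      using m that by (simp add: n)
    have a: "a < 2 ^ r" and b: "(\<Sum>k<r. 2 ^ k * (1 - m (4 + k))) = 2 ^ r - 1 - a"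
      using binary_digits[of r "\<lambda>k. m (4 + k)"] digits by (simp_all add: a_def)
    \<comment> \<open>The source is position 0 of its block; position 15 of the target block yields
      the summand 16.\<close>
    have "PST A (16 * a + 0 + 1) (16 * (2 ^ r - 1 - a) + (15 - 0) + 1) (pi / 2)"
      unfolding A by (rule PST_block_cube[OF F _ a]) auto
    then show ?thesis
      unfolding n sum_from_4 b a_def[symmetric] by (simp add: add.commute)
  qed
  have fid: "fidelity A j k t = fidelity (ncube_mat n) j k t"
    if j: "j \<in> S_set n" and k: "k \<in> {1..2 ^ n}" for j k t
  proof -
    obtain a x where a: "a < 2 ^ r" and x: "x = 0 \<or> x = 15" and jx: "j = 16 * a + x + 1"
      using S_cases[OF j] by blast
    \<comment> \<open>The n-cube is the block cube with \<open>A41\<close> in every block.\<close>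
    show ?thesis
      unfolding A ncube_mat_eq_block_cube r_def[symmetric] jx
      by (rule fidelity_block_cube_cong[OF F _ x a]) (use k N in auto)
  qed
  \<comment> \<open>S itself serves as the set \<open>P\<close>.\<close>
  show ?thesis
    using sub card pairs pst fid by blast
qed

end
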